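(* In the setting and notation described in the context (quadratic lower bounds $w_{i}$, estimate functions $\psi_k$ and augmented estimate functions $\psi'_k$), the augmented estimate sequence gaps $\Gamma_k=A_kF(\mathbf{x}_k)-\min_{\mathbf{x}\in\mathbb{R}^n}\psi'_k(\mathbf{x})$ and the gap sequence $\Delta_k=A_k(F(\mathbf{x}_k)-F(\mathbf{x}^* ))+\frac{\gamma_k}{2}\|\mathbf{v}_k-\mathbf{x}^*\|_2^2$ satisfy $$\Gamma_k=\Delta_k-\Delta_0\qquad\text{for all }k\ge0.$$
   Context: $f:\mathbb{R}^n\to\mathbb{R}$ is convex and differentiable with Lipschitz gradient and strong convexity parameter $\mu_f\ge0$ ($f-\frac{\mu_f}{2}\|\cdot\|_2^2$ convex); $\Psi:\mathbb{R}^n\to\mathbb{R}\cup\{+\infty\}$ is convex, lower semicontinuous, not identically $+\infty$, with strong convexity parameter $\mu_\Psi\ge0$ ($\Psi-\frac{\mu_\Psi}{2}\|\cdot\|_2^2$ convex). $F=f+\Psi$, $\mu=\mu_f+\mu_\Psi$; a minimizer of $F$ is assumed to exist and $\mathbf{x}^*$ is a fixed one. $Q_{\lambda,\mathbf{y}}(\mathbf{x})=f(\mathbf{y})+\langle\nabla f(\mathbf{y}),\mathbf{x}-\mathbf{y}\rangle+\frac{\lambda}{2}\|\mathbf{x}-\mathbf{y}\|_2^2$, and $T_L(\mathbf{y})=\arg\min_{\mathbf{x}}(Q_{L,\mathbf{y}}(\mathbf{x})+\Psi(\mathbf{x}))$ for $L>0$. Given $A_0\ge0$, $\gamma_0>0$,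 $\mathbf{x}_0\in\mathbb{R}^n$, main iterates $\mathbf{x}_k$, and for each $k\ge0$ a weight $a_{k+1}>0$, an $L_{k+1}>0$ and $\mathbf{y}_{k+1}\in\mathbb{R}^n$. Put $A_{k+1}=A_k+a_{k+1}$ and $\mathbf{z}_{k+1}=T_{L_{k+1}}(\mathbf{y}_{k+1})$, and assume the descent condition $f(\mathbf{z}_{k+1})\le Q_{L_{k+1},\mathbf{y}_{k+1}}(\mathbf{z}_{k+1})$ for all $k\ge0$. Simple lower bounds: $$w_{k+1}(\mathbf{x})=F(\mathbf{z}_{k+1})+\tfrac{L_{k+1}+\mu_\Psi}{2}\|\mathbf{z}_{k+1}-\mathbf{y}_{k+1}\|_2^2+(L_{k+1}+\mu_\Psi)\langle\mathbf{y}_{k+1}-\mathbf{z}_{k+1},\mathbf{x}-\mathbf{y}_{k+1}\rangle+\tfrac{\mu}{2}\|\mathbf{x}-\mathbf{y}_{k+1}\|_2^2.$$ Combined lower bounds: $W_k=\bigl(\sum_{i=1}^k a_i\bigr)^{-1}\sum_{i=1}^k a_iw_i$ for $k\ge1$. Estimate functions: $$\psi_k(\mathbf{x})=(A_k-A_0)W_k(\mathbf{x})+A_0F(\mathbf{x}_0)+\tfrac{\gamma_0}{2}\|\mathbf{x}-\mathbf{x}_0\|_2^2,\quad k\ge0,$$ and augmented estimate functions $\psi'_k(\mathbf{x})=\psi_k(\mathbf{x})+(A_k-A_0)(F(\mathbf{x}^* )-W_k(\mathbf{x}^* ))$ (for $k=0$ the terms containing $W_0$, and the factor $A_0-A_0$,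 are absent, so $\psi'_0=\psi_0$). $\mathbf{v}_k=\arg\min_{\mathbf{x}}\psi_k(\mathbf{x})$, and $\gamma_k$ is the curvature of $\psi_k$ (its Hessian is $\gamma_kI_n$), so that $\psi_k(\mathbf{x})=\psi_k^*+\frac{\gamma_k}{2}\|\mathbf{x}-\mathbf{v}_k\|_2^2$ with $\psi_k^*=\min\psi_k$. Conventions: $F(\mathbf{x}_k)<\infty$ for $k\ge1$; $F(\mathbf{x}_0)<\infty$ if $A_0>0$; if $A_0=0$, any term multiplied by $A_0$ is read as $0$. *)

theory Defs
  imports "HOL-Analysis.Analysis"
begin

text \<open>
  Functions with values in \<open>\<real> \<union> {+\<infinity>}\<close> are rendered as functions into \<^typ>\<open>ereal\<close> that do not take
  the value \<open>-\<infinity>\<close>; that side condition is stated separately wherever these notions are used. The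
  library's \<^const>\<open>convex_on\<close> covers real-valued functions only. In \<^typ>\<open>ereal\<close> we have
  \<open>0 * \<infinity> = 0\<close>, so the inequality below is trivial at the endpoints \<open>t = 0\<close> and \<open>t = 1\<close>.
\<close>

definition ext_convex :: "('a::real_vector \<Rightarrow> ereal) \<Rightarrow> bool" where
  "ext_convex h \<longleftrightarrow> (\<forall>x y. \<forall>t\<in>{0..1}.
     h ((1 - t) *\<^sub>R x + t *\<^sub>R y) \<le> ereal (1 - t) * h x + ereal t * h y)"

definition lower_semicontinuous :: "('a::topological_space \<Rightarrow> ereal) \<Rightarrow> bool" where
  "lower_semicontinuous h \<longleftrightarrow> (\<forall>x. h x \<le> Liminf (at x) h)"

definition gradient :: "('a::real_inner \<Rightarrow> real) \<Rightarrow> 'a \<Rightarrow> 'a" where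
  "gradient h x = (THE D. GDERIV h x :> D)"

text \<open>The real number \<open>c\<close> such that \<open>h\<close> is twice differentiable with Hessian \<open>c I\<close> everywhere.\<close>

definition curvature :: "('a::real_inner \<Rightarrow> real) \<Rightarrow> real" where
  "curvature h = (THE c. (\<forall>x. h differentiable (at x)) \<and>
     (\<forall>x. (gradient h has_derivative (\<lambda>d. c *\<^sub>R d)) (at x)))"

definition quad_model :: "('a::real_inner \<Rightarrow> real) \<Rightarrow> real \<Rightarrow> 'a \<Rightarrow> 'a \<Rightarrow> real" where
  "quad_model f lam y x = f y + gradient f y \<bullet> (x - y) + lam / 2 * (norm (x - y))\<^sup>2"

definition prox_grad_step ::
  "('a::real_inner \<Rightarrow> real) \<Rightarrow> ('a \<Rightarrow> ereal) \<Rightarrow> real \<Rightarrow> 'a \<Rightarrow> 'a" where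
  "prox_grad_step f \<Psi> L y = (ARG_MIN (\<lambda>x. ereal (quad_model f L y x) + \<Psi> x) x. True)"

text \<open>
  \<open>simple_lower_bound F \<mu>\<Psi> \<mu> L y z\<close> is the quadratic built at \<open>y\<close> from \<open>z = T\<^sub>L(y)\<close>. The value
  \<open>F z\<close> is finite for such \<open>z\<close> when \<open>\<Psi>\<close> is not identically \<open>+\<infinity>\<close>, so \<^const>\<open>real_of_ereal\<close> is only a type
  conversion.
\<close>

definition simple_lower_bound ::
  "('a::real_inner \<Rightarrow> ereal) \<Rightarrow> real \<Rightarrow> real \<Rightarrow> real \<Rightarrow> 'a \<Rightarrow> 'a \<Rightarrow> 'a \<Rightarrow> real" where
  "simple_lower_bound F \<mu>\<Psi> \<mu> L y z x =
     real_of_ereal (F z) + (L + \<mu>\<Psi>) / 2 * (norm (z - y))\<^sup>2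
     + (L + \<mu>\<Psi>) * ((y - z) \<bullet> (x - y)) + \<mu> / 2 * (norm (x - y))\<^sup>2"

text \<open>
  \<open>combined_lower_bound a w k\<close> is only meaningful for \<open>k \<ge> 1\<close>. For \<open>k = 0\<close> it is \<open>0\<close>, and it then
  occurs below only with the factor \<open>A 0 - A 0\<close>.
\<close>

definition combined_lower_bound ::
  "(nat \<Rightarrow> real) \<Rightarrow> (nat \<Rightarrow> 'a \<Rightarrow> real) \<Rightarrow> nat \<Rightarrow> 'a \<Rightarrow> real" where
  "combined_lower_bound a w k x = inverse (\<Sum>i=1..k. a i) * (\<Sum>i=1..k. a i * w i x)"

text \<open>
  If \<open>A 0 = 0\<close>, then \<open>F x0\<close> may be \<open>+\<infinity>\<close> and the term \<open>A 0 * real_of_ereal (F x0)\<close> is \<open>0\<close>, as intended.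
\<close>

definition estimate_fun ::
  "('a::real_inner \<Rightarrow> ereal) \<Rightarrow> (nat \<Rightarrow> real) \<Rightarrow> (nat \<Rightarrow> 'a \<Rightarrow> real) \<Rightarrow> real \<Rightarrow> 'a \<Rightarrow> nat \<Rightarrow> 'a \<Rightarrow> real" where
  "estimate_fun F A W \<gamma>0 x0 k x =
     (A k - A 0) * W k x + A 0 * real_of_ereal (F x0) + \<gamma>0 / 2 * (norm (x - x0))\<^sup>2"

definition augmented_estimate_fun ::
  "('a::real_inner \<Rightarrow> ereal) \<Rightarrow> (nat \<Rightarrow> real) \<Rightarrow> (nat \<Rightarrow> 'a \<Rightarrow> real) \<Rightarrow> real \<Rightarrow> 'a \<Rightarrow> 'a
    \<Rightarrow> nat \<Rightarrow> 'a \<Rightarrow> real" where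
  "augmented_estimate_fun F A W \<gamma>0 x0 xs k x =
     estimate_fun F A W \<gamma>0 x0 k x + (A k - A 0) * (real_of_ereal (F xs) - W k xs)"

end

theory Submission
  imports Defs
begin

text \<open>
  Every \<open>\<psi> k\<close> is a quadratic with Hessian a positive multiple of the identity, because the
  \<open>w i\<close> have Hessian \<open>\<mu> I\<close> with \<open>\<mu> \<ge> 0\<close>, their combination \<open>W k\<close> enters with the weight
  \<open>A k - A 0 \<ge> 0\<close>, and the term centred at \<open>x 0\<close> adds \<open>\<gamma>0 I\<close> with \<open>\<gamma>0 > 0\<close>. Completing the square therefore gives
  \<open>\<psi> k u = m + \<gamma> k / 2 * (norm (u - v k))\<^sup>2\<close>, where \<open>m\<close> is its minimum
  (\<open>isotropic_quadratic_normal_form\<close>). Since \<open>\<psi>' k\<close> differs from \<open>\<psi> k\<close> by a constant chosen so that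
  the value of \<open>W k\<close> at \<open>xs\<close> is replaced by the true \<open>F xs\<close>, evaluating the normal form at \<open>u = xs\<close>
  cancels every occurrence of \<open>W k\<close>:
  \<open>min (\<psi>' k) = A 0 * F (x 0) + (A k - A 0) * F xs + \<gamma>0 / 2 * (norm (xs - x 0))\<^sup>2
     - \<gamma> k / 2 * (norm (v k - xs))\<^sup>2\<close>.
  Subtracting this from \<open>A k * F (x k)\<close> leaves \<open>\<Delta> k\<close> minus a quantity independent of \<open>k\<close>, and that
  quantity is \<open>\<Delta> 0\<close> because \<open>\<psi> 0\<close> has curvature \<open>\<gamma>0\<close> and minimizer \<open>x 0\<close>.
\<close>

definition isotropic_quadratic :: "real \<Rightarrow> ('a::real_inner \<Rightarrow> real) \<Rightarrow> bool" where
  "isotropic_quadratic c h \<longleftrightarrow> (\<exists>b g. \<forall>x. h x = b + g \<bullet> x + c / 2 * (norm x)\<^sup>2)"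

lemma isotropic_quadratic_const: "isotropic_quadratic 0 (\<lambda>x. b)"
  unfolding isotropic_quadratic_def by (intro exI[of _ b] exI[of _ 0]) simp

lemma isotropic_quadratic_inner: "isotropic_quadratic 0 (\<lambda>x. g \<bullet> (x - y))"
  unfolding isotropic_quadratic_def
  by (intro exI[of _ "- (g \<bullet> y)"] exI[of _ g]) (simp add: inner_diff_right)

lemma isotropic_quadratic_norm_square:
  "isotropic_quadratic c (\<lambda>x. c / 2 * (norm (x - y))\<^sup>2)"
  unfolding isotropic_quadratic_def
  by (intro exI[of _ "c / 2 * (norm y)\<^sup>2"] exI[of _ "- c *\<^sub>R y"])
     (simp add: power2_norm_eq_inner inner_diff_left inner_diff_right inner_commute algebra_simps)

lemma isotropic_quadratic_add:
  assumes "isotropic_quadratic c g" "isotropic_quadratic d h"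
  shows "isotropic_quadratic (c + d) (\<lambda>x. g x + h x)"
proof -
  obtain b1 g1 b2 g2 where
    "\<And>x. g x = b1 + g1 \<bullet> x + c / 2 * (norm x)\<^sup>2" "\<And>x. h x = b2 + g2 \<bullet> x + d / 2 * (norm x)\<^sup>2"
    using assms unfolding isotropic_quadratic_def by metis
  then show ?thesis unfolding isotropic_quadratic_def
    by (intro exI[of _ "b1 + b2"] exI[of _ "g1 + g2"])
       (simp add: inner_add_left algebra_simps add_divide_distrib)
qed

lemma isotropic_quadratic_cmult:
  assumes "isotropic_quadratic c h"
  shows "isotropic_quadratic (r * c) (\<lambda>x. r * h x)"
proof -
  obtain b g where "\<And>x. h x = b + g \<bullet> x + c / 2 * (norm x)\<^sup>2"
    using assms unfolding isotropic_quadratic_def by metis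
  then show ?thesis unfolding isotropic_quadratic_def
    by (intro exI[of _ "r * b"] exI[of _ "r *\<^sub>R g"]) (simp add: algebra_simps)
qed

lemma isotropic_quadratic_sum:
  assumes "\<And>i. i \<in> I \<Longrightarrow> isotropic_quadratic (c i) (h i)"
  shows "isotropic_quadratic (\<Sum>i\<in>I. c i) (\<lambda>x. \<Sum>i\<in>I. h i x)"
  using assms
  by (induction I rule: infinite_finite_induct)
     (simp_all add: isotropic_quadratic_const isotropic_quadratic_add)

lemma isotropic_quadratic_complete_square:
  assumes "isotropic_quadratic c h" "c > 0"
  obtains m p where "h = (\<lambda>x. m + c / 2 * (norm (x - p))\<^sup>2)"
proof -
  obtain b g where h: "\<And>x. h x = b + g \<bullet> x + c / 2 * (norm x)\<^sup>2"
    using assms(1) unfolding isotropic_quadratic_def by metis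
  define p where "p = - (1 / c) *\<^sub>R g"
  have g: "g = - c *\<^sub>R p"
    using assms(2) by (simp add: p_def)
  have "h x = (b - c / 2 * (norm p)\<^sup>2) + c / 2 * (norm (x - p))\<^sup>2" for x
    by (simp add: h g power2_norm_eq_inner inner_diff_left inner_diff_right inner_commute
        algebra_simps)
  then show thesis by (intro that) auto
qed

lemma gradient_norm_square: "gradient (\<lambda>x. m + c / 2 * (norm (x - p))\<^sup>2) u = c *\<^sub>R (u - p)"
  and differentiable_norm_square: "(\<lambda>x. m + c / 2 * (norm (x - p))\<^sup>2) differentiable (at u)"
  for u :: "'a::real_inner"
proof -
  have der: "((\<lambda>x. m + c / 2 * (norm (x - p))\<^sup>2) has_derivative (\<lambda>d. d \<bullet> (c *\<^sub>R (u - p)))) (at u)"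
    unfolding power2_norm_eq_inner
    by (rule derivative_eq_intros refl)+ (simp add: fun_eq_iff inner_commute)
  then show "(\<lambda>x. m + c / 2 * (norm (x - p))\<^sup>2) differentiable (at u)"
    unfolding differentiable_def by blast
  show "gradient (\<lambda>x. m + c / 2 * (norm (x - p))\<^sup>2) u = c *\<^sub>R (u - p)"
    unfolding gradient_def
  proof (rule the_equality)
    show "GDERIV (\<lambda>x. m + c / 2 * (norm (x - p))\<^sup>2) u :> c *\<^sub>R (u - p)"
      using der by (simp add: gderiv_def)
  next
    fix D assume "GDERIV (\<lambda>x. m + c / 2 * (norm (x - p))\<^sup>2) u :> D"
    then have "(\<lambda>d. d \<bullet> D) = (\<lambda>d. d \<bullet> (c *\<^sub>R (u - p)))"
      unfolding gderiv_def using der by (rule has_derivative_unique)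
    then show "D = c *\<^sub>R (u - p)"
      by (metis vector_eq_ldot)
  qed
qed

text \<open>
  A Euclidean space contains a nonzero vector, so the Hessian \<open>c I\<close> determines \<open>c\<close>; in the zero
  space the curvature would not be well defined.
\<close>

lemma curvature_norm_square:
  "curvature (\<lambda>x::'a::euclidean_space. m + c / 2 * (norm (x - p))\<^sup>2) = c"
  unfolding curvature_def
proof (rule the_equality)
  have "((\<lambda>u. c *\<^sub>R (u - p)) has_derivative (\<lambda>d. c *\<^sub>R d)) (at u)" for u
    by (rule derivative_eq_intros refl)+ (simp add: fun_eq_iff)
  then have hess: "(gradient (\<lambda>x. m + c / 2 * (norm (x - p))\<^sup>2) has_derivative (\<lambda>d. c *\<^sub>R d)) (at u)"
    for u by (simp only: gradient_norm_square[abs_def])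
  then show "(\<forall>u. (\<lambda>x. m + c / 2 * (norm (x - p))\<^sup>2) differentiable (at u)) \<and>
    (\<forall>u. (gradient (\<lambda>x. m + c / 2 * (norm (x - p))\<^sup>2) has_derivative (\<lambda>d. c *\<^sub>R d)) (at u))"
    by (blast intro: differentiable_norm_square)
  fix c' assume "(\<forall>u. (\<lambda>x. m + c / 2 * (norm (x - p))\<^sup>2) differentiable (at u)) \<and>
    (\<forall>u. (gradient (\<lambda>x. m + c / 2 * (norm (x - p))\<^sup>2) has_derivative (\<lambda>d. c' *\<^sub>R d)) (at u))"
  then have "(\<lambda>d. c' *\<^sub>R d) = (\<lambda>d::'a. c *\<^sub>R d)"
    using hess has_derivative_unique by blast
  moreover obtain e :: 'a where "e \<in> Basis" using nonempty_Basis by blast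
  ultimately show "c' = c"
    by (metis nonzero_Basis scaleR_cancel_right)
qed

lemma arg_min_norm_square:
  assumes "c > 0"
  shows "(ARG_MIN (\<lambda>x::'a::real_normed_vector. m + c / 2 * (norm (x - p))\<^sup>2) x. True) = p"
  unfolding arg_min_def
proof (rule some_equality)
  show "is_arg_min (\<lambda>x. m + c / 2 * (norm (x - p))\<^sup>2) (\<lambda>x. True) p"
    using assms by (simp add: is_arg_min_linorder)
next
  fix q assume "is_arg_min (\<lambda>x. m + c / 2 * (norm (x - p))\<^sup>2) (\<lambda>x. True) q"
  then have "m + c / 2 * (norm (q - p))\<^sup>2 \<le> m + c / 2 * (norm (p - p))\<^sup>2"
    unfolding is_arg_min_linorder by blast
  then show "q = p"
    using assms by (simp add: mult_le_0_iff)
qed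

lemma Least_range_norm_square:
  assumes "c \<ge> 0"
  shows "(LEAST r. r \<in> range (\<lambda>x::'a::real_normed_vector. m + c / 2 * (norm (x - p))\<^sup>2)) = m"
proof (rule Least_equality)
  show "m \<in> range (\<lambda>x. m + c / 2 * (norm (x - p))\<^sup>2)"
    by (rule range_eqI[of _ _ p]) simp
qed (use assms in auto)

text \<open>
  Completing the square exhibits some centre and leading coefficient; they agree with the minimizer
  and the curvature, which are defined by choice and description operators.
\<close>

lemma isotropic_quadratic_normal_form:
  fixes h :: "'a::euclidean_space \<Rightarrow> real"
  assumes "isotropic_quadratic c h" "c > 0"
  obtains m where "h = (\<lambda>x. m + curvature h / 2 * (norm (x - (ARG_MIN h u. True)))\<^sup>2)"
    and "curvature h = c"
proof -
  obtain m p where h: "h = (\<lambda>x. m + c / 2 * (norm (x - p))\<^sup>2)"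
    using isotropic_quadratic_complete_square[OF assms] .
  have "curvature h = c" "(ARG_MIN h u. True) = p"
    unfolding h by (rule curvature_norm_square, rule arg_min_norm_square[OF assms(2)])
  then show thesis using h that by metis
qed

text \<open>
  The value at an arbitrary point, rather than at the minimizer, determines the minimum of a shifted
  quadratic. Applied at \<open>xs\<close>, this removes the lower bound \<open>W k\<close> from the minimum of
  \<open>\<psi>' k\<close>.
\<close>

lemma Least_range_shifted_quadratic:
  fixes h :: "'a::euclidean_space \<Rightarrow> real"
  assumes "isotropic_quadratic c h" "c > 0"
  shows "(LEAST r. r \<in> range (\<lambda>u. h u + d)) =
    h q + d - curvature h / 2 * (norm ((ARG_MIN h u. True) - q))\<^sup>2"
proof -
  define p where "p = (ARG_MIN h u. True)"
  obtain m where h: "h = (\<lambda>x. m + curvature h / 2 * (norm (x - p))\<^sup>2)" and c: "curvature h = c"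
    using isotropic_quadratic_normal_form[OF assms] unfolding p_def .
  have "(\<lambda>u. h u + d) = (\<lambda>u. (m + d) + c / 2 * (norm (u - p))\<^sup>2)"
    by (subst h) (simp add: c fun_eq_iff)
  then have "(LEAST r. r \<in> range (\<lambda>u. h u + d)) = m + d"
    using assms(2) by (simp only: Least_range_norm_square less_imp_le)
  moreover have "h q = m + curvature h / 2 * (norm (p - q))\<^sup>2"
    using fun_cong[OF h, of q] by (simp add: norm_minus_commute)
  ultimately show ?thesis by (simp add: p_def)
qed

lemma isotropic_quadratic_simple_lower_bound:
  "isotropic_quadratic \<mu> (simple_lower_bound F \<mu>\<Psi> \<mu> L y z)"
proof -
  have "isotropic_quadratic (0 + (L + \<mu>\<Psi>) * 0 + \<mu>)
    (\<lambda>x. (real_of_ereal (F z) + (L + \<mu>\<Psi>) / 2 * (norm (z - y))\<^sup>2)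
      + (L + \<mu>\<Psi>) * ((y - z) \<bullet> (x - y)) + \<mu> / 2 * (norm (x - y))\<^sup>2)"
    by (intro isotropic_quadratic_add isotropic_quadratic_const isotropic_quadratic_cmult
        isotropic_quadratic_inner isotropic_quadratic_norm_square)
  then show ?thesis
    by (simp add: simple_lower_bound_def[abs_def])
qed

lemma isotropic_quadratic_combined_lower_bound:
  assumes "\<And>i. i \<in> {1..k} \<Longrightarrow> isotropic_quadratic c (w i)"
  shows "isotropic_quadratic (inverse (\<Sum>i=1..k. a i) * (\<Sum>i=1..k. a i * c))
    (combined_lower_bound a w k)"
  unfolding combined_lower_bound_def[abs_def]
  by (intro isotropic_quadratic_cmult isotropic_quadratic_sum assms)

lemma isotropic_quadratic_estimate_fun:
  assumes "isotropic_quadratic c (W k)"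
  shows "isotropic_quadratic ((A k - A 0) * c + \<gamma>0) (estimate_fun F A W \<gamma>0 x0 k)"
proof -
  have "isotropic_quadratic ((A k - A 0) * c + 0 + \<gamma>0) (estimate_fun F A W \<gamma>0 x0 k)"
    unfolding estimate_fun_def[abs_def]
    by (intro isotropic_quadratic_add isotropic_quadratic_const isotropic_quadratic_cmult
        isotropic_quadratic_norm_square assms)
  then show ?thesis by simp
qed

theorem proposition2p3:
  fixes f :: "real ^ 'n \<Rightarrow> real"
    and \<Psi> F :: "real ^ 'n \<Rightarrow> ereal"
    and \<mu>f \<mu>\<Psi> \<mu> \<gamma>0 :: real
    and xs :: "real ^ 'n"
    and x y z v :: "nat \<Rightarrow> real ^ 'n"
    and a A L \<gamma> \<Gamma> \<Delta> :: "nat \<Rightarrow> real"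
    and w W \<psi> \<psi>' :: "nat \<Rightarrow> real ^ 'n \<Rightarrow> real"
  assumes "convex_on UNIV f"
    and "\<And>u. f differentiable (at u)"
    and "\<exists>Lf. Lf-lipschitz_on UNIV (gradient f)"
    and "\<mu>f \<ge> 0"
    and "convex_on UNIV (\<lambda>u. f u - \<mu>f / 2 * (norm u)\<^sup>2)"
    and "\<And>u. \<Psi> u \<noteq> -\<infinity>"
    and "\<exists>u. \<Psi> u \<noteq> \<infinity>"
    and "ext_convex \<Psi>"
    and "lower_semicontinuous \<Psi>"
    and "\<mu>\<Psi> \<ge> 0"
    and "ext_convex (\<lambda>u. \<Psi> u - ereal (\<mu>\<Psi> / 2 * (norm u)\<^sup>2))"
    and F: "\<And>u. F u = ereal (f u) + \<Psi> u"
    and \<mu>: "\<mu> = \<mu>f + \<mu>\<Psi>"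
    and xs: "is_arg_min F (\<lambda>_. True) xs"
    and "A 0 \<ge> 0"
    and "\<gamma>0 > 0"
    and "\<And>k. a (Suc k) > 0"
    and "\<And>k. L (Suc k) > 0"
    and A: "\<And>k. A (Suc k) = A k + a (Suc k)"
    and z: "\<And>k. z (Suc k) = prox_grad_step f \<Psi> (L (Suc k)) (y (Suc k))"
    and "\<And>k. f (z (Suc k)) \<le> quad_model f (L (Suc k)) (y (Suc k)) (z (Suc k))"
    and "\<And>k. k \<ge> 1 \<Longrightarrow> F (x k) < \<infinity>"
    and "A 0 > 0 \<Longrightarrow> F (x 0) < \<infinity>"
    and w: "\<And>k. w (Suc k) = simple_lower_bound F \<mu>\<Psi> \<mu> (L (Suc k)) (y (Suc k)) (z (Suc k))"
    and W: "\<And>k. W k = combined_lower_bound a w k"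
    and \<psi>: "\<And>k. \<psi> k = estimate_fun F A W \<gamma>0 (x 0) k"
    and \<psi>': "\<And>k. \<psi>' k = augmented_estimate_fun F A W \<gamma>0 (x 0) xs k"
    and v: "\<And>k. v k = (ARG_MIN (\<psi> k) u. True)"
    and \<gamma>: "\<And>k. \<gamma> k = curvature (\<psi> k)"
    and \<Gamma>: "\<And>k. \<Gamma> k = A k * real_of_ereal (F (x k)) - (LEAST m. m \<in> range (\<psi>' k))"
    and \<Delta>: "\<And>k. \<Delta> k = A k * (real_of_ereal (F (x k)) - real_of_ereal (F xs))
                     + \<gamma> k / 2 * (norm (v k - xs))\<^sup>2"
  shows "\<forall>k. \<Gamma> k = \<Delta> k - \<Delta> 0"
proof
  fix k
  have mu_nonneg: "\<mu> \<ge> 0" using \<mu> \<open>\<mu>f \<ge> 0\<close> \<open>\<mu>\<Psi> \<ge> 0\<close> by simp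
  have a_pos: "a i > 0" if "i \<in> {1..j}" for i j
    using that \<open>\<And>k. a (Suc k) > 0\<close> by (cases i) auto
  have A_mono: "A 0 \<le> A j" for j
  proof (induction j)
    case (Suc j)
    then show ?case using A[of j] \<open>\<And>k. a (Suc k) > 0\<close>[of j] by simp
  qed simp
  have w_quadratic: "isotropic_quadratic \<mu> (w i)" if "i \<in> {1..j}" for i j
    using that w by (cases i) (auto simp: isotropic_quadratic_simple_lower_bound)
  \<comment> \<open>Leaving the average unsimplified avoids a case split: it equals \<open>\<mu>\<close> for \<open>j \<ge> 1\<close>, but \<open>0\<close> for
    \<open>j = 0\<close>, where \<open>W 0\<close> is the zero function. Only its sign matters.\<close>
  define c where "c j = inverse (\<Sum>i=1..j. a i) * (\<Sum>i=1..j. a i * \<mu>)" for j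
  have W_quadratic: "isotropic_quadratic (c j) (W j)" for j
    unfolding W c_def by (intro isotropic_quadratic_combined_lower_bound w_quadratic)
  have c_nonneg: "c j \<ge> 0" for j
    unfolding c_def
    by (intro mult_nonneg_nonneg sum_nonneg iffD2[OF inverse_nonnegative_iff_nonnegative])
       (use a_pos mu_nonneg in \<open>auto intro: less_imp_le\<close>)
  have psi_quadratic: "isotropic_quadratic ((A k - A 0) * c k + \<gamma>0) (\<psi> k)"
    unfolding \<psi> by (intro isotropic_quadratic_estimate_fun W_quadratic)
  have curvature_pos: "(A k - A 0) * c k + \<gamma>0 > 0"
    using A_mono[of k] c_nonneg[of k] \<open>\<gamma>0 > 0\<close> by (simp add: add_nonneg_pos)

  have "(LEAST m. m \<in> range (\<psi>' k)) =
    \<psi> k xs + (A k - A 0) * (real_of_ereal (F xs) - W k xs) - \<gamma> k / 2 * (norm (v k - xs))\<^sup>2"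
    using Least_range_shifted_quadratic[OF psi_quadratic curvature_pos,
        of "(A k - A 0) * (real_of_ereal (F xs) - W k xs)" xs]
    by (simp add: \<psi>' augmented_estimate_fun_def[abs_def] \<psi>[symmetric] \<gamma> v)
  then have min_psi': "(LEAST m. m \<in> range (\<psi>' k)) =
    A 0 * real_of_ereal (F (x 0)) + (A k - A 0) * real_of_ereal (F xs)
      + \<gamma>0 / 2 * (norm (xs - x 0))\<^sup>2 - \<gamma> k / 2 * (norm (v k - xs))\<^sup>2"
    by (simp add: \<psi> estimate_fun_def algebra_simps)

  have psi_0: "\<psi> 0 = (\<lambda>u. A 0 * real_of_ereal (F (x 0)) + \<gamma>0 / 2 * (norm (u - x 0))\<^sup>2)"
    by (simp add: \<psi> estimate_fun_def fun_eq_iff)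
  have "\<gamma> 0 = \<gamma>0"
    unfolding \<gamma> psi_0 by (rule curvature_norm_square)
  moreover have "v 0 = x 0"
    unfolding v psi_0 by (rule arg_min_norm_square[OF \<open>\<gamma>0 > 0\<close>])
  ultimately have "\<Delta> 0 = A 0 * (real_of_ereal (F (x 0)) - real_of_ereal (F xs))
      + \<gamma>0 / 2 * (norm (xs - x 0))\<^sup>2"
    by (simp add: \<Delta> norm_minus_commute)
  with min_psi' show "\<Gamma> k = \<Delta> k - \<Delta> 0"
    by (simp add: \<Gamma> \<Delta>[of k] algebra_simps)
qed

end
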